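(* The selection category functor $\mathcal{S}_{-}\colon\mathbf{Cat}\to\mathbb{P}\mathbf{rof}\text{-}\mathbf{Cat}$ restricts to functors $$\mathcal{S}_{-}\colon\mathbf{Cat}_{bo}\longrightarrow\mathbb{P}\mathbf{rof}_{bo}\text{-}\mathbf{Cat}\qquad\text{and}\qquad\mathcal{S}_{-}\colon\mathbf{Cat}_{f\!f}\longrightarrow\mathbb{P}\mathbf{rof}_{f\!f}\text{-}\mathbf{Cat},$$ meaning that if a functor $F\colon\mathcal{C}\to\mathcal{C}'$ between small categories is bijective on objects (resp. fully faithful), then so is the functor $\mathcal{S}_F(p)\colon\mathcal{S}_{\mathcal{C}}(p)\to\mathcal{S}_{\mathcal{C}'}(p)$ for each polynomial functor $p\colon\mathbf{Set}\to\mathbf{Set}$.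
   Context: A polynomial functor is a coproduct of representables $p=\sum_{i\in I}\mathbf{Set}(A_i,-)\colon\mathbf{Set}\to\mathbf{Set}$; $\mathbf{Poly}$ is the category of these. Selection category $\mathcal{S}_{\mathcal{C}}(p)$: objects are pairs $(i,c)$ with $i\in I$, $c\colon A_i\to\mathrm{Ob}\,\mathcal{C}$; morphisms $(i,c)\to(i',c')$ are elements of $\prod_{a'\in A_{i'}}\sum_{a\in A_i}\mathcal{C}(c_a,c'_{a'})$, i.e. pairs $(\varphi,f)$ with $\varphi\colon A_{i'}\to A_i$ and $f_{a'}\colon c_{\varphi(a')}\to c'_{a'}$; identities and composition are the evident ones. For a functor $F\colon\mathcal{C}\to\mathcal{C}'$, $\mathcal{S}_F(p)$ sends $(i,c)\mapsto(i,F\circ c)$ and $(\varphi,f)\mapsto(\varphi,F(f))$. $\mathbb{P}\mathbf{rof}$ is the double category of categories, functors (tight morphisms), and profunctors. A $\mathbb{P}\mathbf{rof}$-enriched category $S$ has a collection of objects $p$, a category $S(p)$ for each, a profunctor $\mathrm{Hom}_S(p,q)\colon S(p)^{\mathrm{op}}\times S(q)\to\mathbf{Set}$ for each pair, and unital associative unit and composition maps; an enriched functor has a map on objects, functors $F_p\colon S(p)\to S'(Fp)$, and compatible natural maps on the profunctors. (Size convention: $\mathrm{Ob}\,\mathbf{Poly}$ is allowed as an object collection.) The functor $\mathcal{S}_{-}$ sends $\mathcal{C}$ to the enriched category with objects $\mathrm{Ob}\,\mathbf{Poly}$, categories $\mathcal{S}_{\mathcal{C}}(p)$, and, for $q=\sum_{j\in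 J}\mathbf{Set}(B_j,-)$, profunctors $\mathrm{Hom}_{\mathcal{S}_{\mathcal{C}}}(p,q)\big((i,c),(j,d)\big)=\prod_{b\in B_j}\sum_{a\in A_i}\mathcal{C}(c(a),d(b))$ with evident composition, and sends $F$ to the identity-on-objects enriched functor with components $\mathcal{S}_F(p)$ and $(\beta,g)\mapsto(\beta,F(g))$ on profunctor elements. $\mathbf{Cat}_{bo}$ (resp. $\mathbf{Cat}_{f\!f}$) is the wide subcategory of $\mathbf{Cat}$ on bijective-on-objects (resp. fully faithful) functors. $\mathbb{P}\mathbf{rof}_{bo}$ (resp. $\mathbb{P}\mathbf{rof}_{f\!f}$) is the wide, locally full sub-double-category of $\mathbb{P}\mathbf{rof}$ whose tight morphisms are bijective-on-objects (resp. fully faithful) functors, and $\mathbb{P}\mathbf{rof}_{bo}\text{-}\mathbf{Cat}$ (resp. $\mathbb{P}\mathbf{rof}_{f\!f}\text{-}\mathbf{Cat}$) is the category of categories enriched in it and their enriched functors (so every component functor $F_p$ is bijective on objects, resp. fully faithful). *)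

theory Defs
  imports "HOL-Library.FuncSet"
begin

text \<open>Hom-sets are indexed by source and target and need not be disjoint.
  \<open>Cmp C x y z g f\<close> is the composite of \<open>f : x \<rightarrow> y\<close> followed by \<open>g : y \<rightarrow> z\<close>.\<close>

record ('o, 'm) cat =
  Obj :: "'o set"
  Arr :: "'o \<Rightarrow> 'o \<Rightarrow> 'm set"
  Ident :: "'o \<Rightarrow> 'm"
  Cmp :: "'o \<Rightarrow> 'o \<Rightarrow> 'o \<Rightarrow> 'm \<Rightarrow> 'm \<Rightarrow> 'm"

locale category =
  fixes C :: "('o, 'm) cat"
  assumes ident_in: "x \<in> Obj C \<Longrightarrow> Ident C x \<in> Arr C x x"
    and cmp_in: "\<lbrakk>x \<in> Obj C; y \<in> Obj C; z \<in> Obj C; f \<in> Arr C x y; g \<in> Arr C y z\<rbrakk>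
      \<Longrightarrow> Cmp C x y z g f \<in> Arr C x z"
    and cmp_ident_right: "\<lbrakk>x \<in> Obj C; y \<in> Obj C; f \<in> Arr C x y\<rbrakk>
      \<Longrightarrow> Cmp C x x y f (Ident C x) = f"
    and cmp_ident_left: "\<lbrakk>x \<in> Obj C; y \<in> Obj C; f \<in> Arr C x y\<rbrakk>
      \<Longrightarrow> Cmp C x y y (Ident C y) f = f"
    and cmp_assoc: "\<lbrakk>w \<in> Obj C; x \<in> Obj C; y \<in> Obj C; z \<in> Obj C;
        f \<in> Arr C w x; g \<in> Arr C x y; h \<in> Arr C y z\<rbrakk>
      \<Longrightarrow> Cmp C w x z (Cmp C x y z h g) f = Cmp C w y z h (Cmp C w x y g f)"

record ('o, 'm, 'o2, 'm2) func =
  Fobj :: "'o \<Rightarrow> 'o2"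
  Fmor :: "'o \<Rightarrow> 'o \<Rightarrow> 'm \<Rightarrow> 'm2"

locale cat_functor = C: category C + D: category D
  for C :: "('o, 'm) cat" and D :: "('o2, 'm2) cat" +
  fixes F :: "('o, 'm, 'o2, 'm2) func"
  assumes obj_in: "x \<in> Obj C \<Longrightarrow> Fobj F x \<in> Obj D"
    and mor_in: "\<lbrakk>x \<in> Obj C; y \<in> Obj C; f \<in> Arr C x y\<rbrakk>
      \<Longrightarrow> Fmor F x y f \<in> Arr D (Fobj F x) (Fobj F y)"
    and mor_ident: "x \<in> Obj C \<Longrightarrow> Fmor F x x (Ident C x) = Ident D (Fobj F x)"
    and mor_cmp: "\<lbrakk>x \<in> Obj C; y \<in> Obj C; z \<in> Obj C; f \<in> Arr C x y; g \<in> Arr C y z\<rbrakk>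
      \<Longrightarrow> Fmor F x z (Cmp C x y z g f)
        = Cmp D (Fobj F x) (Fobj F y) (Fobj F z) (Fmor F y z g) (Fmor F x y f)"

definition bij_on_objects :: "('o, 'm) cat \<Rightarrow> ('o2, 'm2) cat \<Rightarrow> ('o, 'm, 'o2, 'm2) func \<Rightarrow> bool" where
  "bij_on_objects C D F \<longleftrightarrow> bij_betw (Fobj F) (Obj C) (Obj D)"

definition fully_faithful :: "('o, 'm) cat \<Rightarrow> ('o2, 'm2) cat \<Rightarrow> ('o, 'm, 'o2, 'm2) func \<Rightarrow> bool" where
  "fully_faithful C D F \<longleftrightarrow> (\<forall>x\<in>Obj C. \<forall>y\<in>Obj C.
     bij_betw (Fmor F x y) (Arr C x y) (Arr D (Fobj F x) (Fobj F y)))"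

definition id_func :: "('o, 'm, 'o, 'm) func" where
  "id_func = \<lparr>Fobj = (\<lambda>x. x), Fmor = (\<lambda>x y f. f)\<rparr>"

definition comp_func :: "('o2, 'm2, 'o3, 'm3) func \<Rightarrow> ('o, 'm, 'o2, 'm2) func
    \<Rightarrow> ('o, 'm, 'o3, 'm3) func" where
  "comp_func G F = \<lparr>Fobj = (\<lambda>x. Fobj G (Fobj F x)),
     Fmor = (\<lambda>x y f. Fmor G (Fobj F x) (Fobj F y) (Fmor F x y f))\<rparr>"

text \<open>A record of type \<open>func\<close> also has values outside its domain category.
  \<open>func_restrict C F\<close> is the representative that is \<open>undefined\<close> there;
  two functors on \<open>C\<close> are equal as functors iff these representatives coincide.\<close>

definition func_restrict :: "('o, 'm) cat \<Rightarrow> ('o, 'm, 'o2, 'm2) func \<Rightarrow> ('o, 'm, 'o2, 'm2) func" where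
  "func_restrict C F = \<lparr>Fobj = (\<lambda>x\<in>Obj C. Fobj F x),
     Fmor = (\<lambda>x\<in>Obj C. \<lambda>y\<in>Obj C. \<lambda>f\<in>Arr C x y. Fmor F x y f)\<rparr>"

text \<open>The category of all categories whose objects and morphisms are drawn from the
  types \<open>'o\<close> and \<open>'m\<close>, which play the role of the universe of small sets.\<close>

definition Cat :: "(('o, 'm) cat, ('o, 'm, 'o, 'm) func) cat" where
  "Cat = \<lparr>Obj = {C. category C},
     Arr = (\<lambda>C D. {F. cat_functor C D F \<and> func_restrict C F = F}),
     Ident = (\<lambda>C. func_restrict C id_func),
     Cmp = (\<lambda>C D E G F. func_restrict C (comp_func G F))\<rparr>"

definition wide_subcat :: "('o, 'm) cat \<Rightarrow> ('o \<Rightarrow> 'o \<Rightarrow> 'm \<Rightarrow> bool) \<Rightarrow> ('o, 'm) cat" where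
  "wide_subcat C P = C\<lparr>Arr := (\<lambda>x y. {f \<in> Arr C x y. P x y f})\<rparr>"

definition Cat_bo :: "(('o, 'm) cat, ('o, 'm, 'o, 'm) func) cat" where
  "Cat_bo = wide_subcat Cat bij_on_objects"

definition Cat_ff :: "(('o, 'm) cat, ('o, 'm, 'o, 'm) func) cat" where
  "Cat_ff = wide_subcat Cat fully_faithful"

definition op_cat :: "('o, 'm) cat \<Rightarrow> ('o, 'm) cat" where
  "op_cat C = \<lparr>Obj = Obj C, Arr = (\<lambda>x y. Arr C y x), Ident = Ident C,
     Cmp = (\<lambda>x y z g f. Cmp C z y x f g)\<rparr>"

definition prod_cat :: "('o, 'm) cat \<Rightarrow> ('o2, 'm2) cat \<Rightarrow> ('o \<times> 'o2, 'm \<times> 'm2) cat" where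
  "prod_cat C D = \<lparr>Obj = Obj C \<times> Obj D,
     Arr = (\<lambda>(x, y) (x', y'). Arr C x x' \<times> Arr D y y'),
     Ident = (\<lambda>(x, y). (Ident C x, Ident D y)),
     Cmp = (\<lambda>(x, y) (x', y') (x'', y'') (u', v') (u, v).
       (Cmp C x x' x'' u' u, Cmp D y y' y'' v' v))\<rparr>"

definition set_cat :: "('h set, 'h \<Rightarrow> 'h) cat" where
  "set_cat = \<lparr>Obj = UNIV, Arr = (\<lambda>X Y. X \<rightarrow>\<^sub>E Y), Ident = (\<lambda>X. \<lambda>x\<in>X. x),
     Cmp = (\<lambda>X Y Z g f. compose X g f)\<rparr>"

type_synonym ('o, 'm, 'o2, 'm2, 'h) prof = "('o \<times> 'o2, 'm \<times> 'm2, 'h set, 'h \<Rightarrow> 'h) func"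

definition profunctor :: "('o, 'm) cat \<Rightarrow> ('o2, 'm2) cat \<Rightarrow> ('o, 'm, 'o2, 'm2, 'h) prof \<Rightarrow> bool" where
  "profunctor C D P \<longleftrightarrow> cat_functor (prod_cat (op_cat C) D) set_cat P"

definition hom_prof :: "('o, 'm) cat \<Rightarrow> ('o, 'm, 'o, 'm, 'm) prof" where
  "hom_prof C = \<lparr>Fobj = (\<lambda>(x, y). Arr C x y),
     Fmor = (\<lambda>(x, y) (x', y') (u, v). \<lambda>f\<in>Arr C x y. Cmp C x' y y' v (Cmp C x' x y f u))\<rparr>"

text \<open>A square of the double category of profunctors: a family of maps
  \<open>P(x, y) \<rightarrow> Q(F x, G y)\<close>, natural in \<open>x\<close> and \<open>y\<close>.\<close>

definition prof_square :: "('o, 'm) cat \<Rightarrow> ('o2, 'm2) cat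
    \<Rightarrow> ('o, 'm, 'p, 'n) func \<Rightarrow> ('o2, 'm2, 'p2, 'n2) func
    \<Rightarrow> ('o, 'm, 'o2, 'm2, 'h) prof \<Rightarrow> ('p, 'n, 'p2, 'n2, 'k) prof
    \<Rightarrow> ('o \<Rightarrow> 'o2 \<Rightarrow> 'h \<Rightarrow> 'k) \<Rightarrow> bool" where
  "prof_square C D F G P Q \<alpha> \<longleftrightarrow>
     (\<forall>x\<in>Obj C. \<forall>y\<in>Obj D. \<forall>h\<in>Fobj P (x, y). \<alpha> x y h \<in> Fobj Q (Fobj F x, Fobj G y)) \<and>
     (\<forall>x\<in>Obj C. \<forall>x'\<in>Obj C. \<forall>y\<in>Obj D. \<forall>y'\<in>Obj D.
       \<forall>u\<in>Arr C x' x. \<forall>v\<in>Arr D y y'. \<forall>h\<in>Fobj P (x, y).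
         \<alpha> x' y' (Fmor P (x, y) (x', y') (u, v) h)
         = Fmor Q (Fobj F x, Fobj G y) (Fobj F x', Fobj G y')
             (Fmor F x' x u, Fmor G y y' v) (\<alpha> x y h))"

text \<open>A globular square from the composite of \<open>P\<close> and \<open>Q\<close> to \<open>R\<close>.  The composite
  is the coend of \<open>P(x, y) \<times> Q(y, z)\<close> over \<open>y\<close>, so a map out of it is a family
  \<open>P(x, y) \<times> Q(y, z) \<rightarrow> R(x, z)\<close> that is natural in \<open>x\<close> and \<open>z\<close> and dinatural in \<open>y\<close>.\<close>

definition prof_comp_map :: "('o, 'm) cat \<Rightarrow> ('o2, 'm2) cat \<Rightarrow> ('o3, 'm3) cat
    \<Rightarrow> ('o, 'm, 'o2, 'm2, 'h) prof \<Rightarrow> ('o2, 'm2, 'o3, 'm3, 'k) prof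
    \<Rightarrow> ('o, 'm, 'o3, 'm3, 'l) prof \<Rightarrow> ('o \<Rightarrow> 'o2 \<Rightarrow> 'o3 \<Rightarrow> 'h \<Rightarrow> 'k \<Rightarrow> 'l) \<Rightarrow> bool" where
  "prof_comp_map C D E P Q R \<mu> \<longleftrightarrow>
     (\<forall>x\<in>Obj C. \<forall>y\<in>Obj D. \<forall>z\<in>Obj E. \<forall>h\<in>Fobj P (x, y). \<forall>k\<in>Fobj Q (y, z).
        \<mu> x y z h k \<in> Fobj R (x, z)) \<and>
     (\<forall>x\<in>Obj C. \<forall>x'\<in>Obj C. \<forall>y\<in>Obj D. \<forall>z\<in>Obj E. \<forall>z'\<in>Obj E.
        \<forall>u\<in>Arr C x' x. \<forall>w\<in>Arr E z z'. \<forall>h\<in>Fobj P (x, y). \<forall>k\<in>Fobj Q (y, z).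
          \<mu> x' y z' (Fmor P (x, y) (x', y) (u, Ident D y) h)
                    (Fmor Q (y, z) (y, z') (Ident D y, w) k)
          = Fmor R (x, z) (x', z') (u, w) (\<mu> x y z h k)) \<and>
     (\<forall>x\<in>Obj C. \<forall>y\<in>Obj D. \<forall>y'\<in>Obj D. \<forall>z\<in>Obj E.
        \<forall>v\<in>Arr D y y'. \<forall>h\<in>Fobj P (x, y). \<forall>k\<in>Fobj Q (y', z).
          \<mu> x y' z (Fmor P (x, y) (x, y') (Ident C x, v) h) k
          = \<mu> x y z h (Fmor Q (y', z) (y, z) (v, Ident E z) k))"

text \<open>\<open>EComp S p q r x y z h k\<close> is in diagrammatic order: \<open>h\<close> is in \<open>Hom(p, q)(x, y)\<close> and
  \<open>k\<close> is in \<open>Hom(q, r)(y, z)\<close>.\<close>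

record ('p, 'o, 'm, 'h) ecat =
  EOb :: "'p set"
  ECat :: "'p \<Rightarrow> ('o, 'm) cat"
  EHom :: "'p \<Rightarrow> 'p \<Rightarrow> ('o, 'm, 'o, 'm, 'h) prof"
  EUnit :: "'p \<Rightarrow> 'o \<Rightarrow> 'o \<Rightarrow> 'm \<Rightarrow> 'h"
  EComp :: "'p \<Rightarrow> 'p \<Rightarrow> 'p \<Rightarrow> 'o \<Rightarrow> 'o \<Rightarrow> 'o \<Rightarrow> 'h \<Rightarrow> 'h \<Rightarrow> 'h"

text \<open>In the unit laws, the isomorphism between a profunctor and its composite with a hom
  profunctor is the action.\<close>

locale prof_category =
  fixes S :: "('p, 'o, 'm, 'h) ecat"
  assumes ecat: "p \<in> EOb S \<Longrightarrow> category (ECat S p)"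
    and ehom: "\<lbrakk>p \<in> EOb S; q \<in> EOb S\<rbrakk> \<Longrightarrow> profunctor (ECat S p) (ECat S q) (EHom S p q)"
    and eunit: "p \<in> EOb S \<Longrightarrow>
      prof_square (ECat S p) (ECat S p) id_func id_func (hom_prof (ECat S p)) (EHom S p p) (EUnit S p)"
    and ecomp: "\<lbrakk>p \<in> EOb S; q \<in> EOb S; r \<in> EOb S\<rbrakk> \<Longrightarrow>
      prof_comp_map (ECat S p) (ECat S q) (ECat S r)
        (EHom S p q) (EHom S q r) (EHom S p r) (EComp S p q r)"
    and eunit_left: "\<lbrakk>p \<in> EOb S; q \<in> EOb S; x \<in> Obj (ECat S p); y \<in> Obj (ECat S p);
        z \<in> Obj (ECat S q); u \<in> Arr (ECat S p) x y; h \<in> Fobj (EHom S p q) (y, z)\<rbrakk> \<Longrightarrow>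
      EComp S p p q x y z (EUnit S p x y u) h
      = Fmor (EHom S p q) (y, z) (x, z) (u, Ident (ECat S q) z) h"
    and eunit_right: "\<lbrakk>p \<in> EOb S; q \<in> EOb S; x \<in> Obj (ECat S p); y \<in> Obj (ECat S q);
        z \<in> Obj (ECat S q); h \<in> Fobj (EHom S p q) (x, y); v \<in> Arr (ECat S q) y z\<rbrakk> \<Longrightarrow>
      EComp S p q q x y z h (EUnit S q y z v)
      = Fmor (EHom S p q) (x, y) (x, z) (Ident (ECat S p) x, v) h"
    and eassoc: "\<lbrakk>p \<in> EOb S; q \<in> EOb S; r \<in> EOb S; s \<in> EOb S;
        w \<in> Obj (ECat S p); x \<in> Obj (ECat S q); y \<in> Obj (ECat S r); z \<in> Obj (ECat S s);
        h \<in> Fobj (EHom S p q) (w, x); k \<in> Fobj (EHom S q r) (x, y); l \<in> Fobj (EHom S r s) (y, z)\<rbrakk> \<Longrightarrow>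
      EComp S p r s w y z (EComp S p q r w x y h k) l
      = EComp S p q s w x z h (EComp S q r s x y z k l)"

record ('p, 'o, 'm, 'h, 'p2, 'o2, 'm2, 'h2) efunc =
  EFobj :: "'p \<Rightarrow> 'p2"
  EFcat :: "'p \<Rightarrow> ('o, 'm, 'o2, 'm2) func"
  EFhom :: "'p \<Rightarrow> 'p \<Rightarrow> 'o \<Rightarrow> 'o \<Rightarrow> 'h \<Rightarrow> 'h2"

locale prof_functor = S: prof_category S + T: prof_category T
  for S :: "('p, 'o, 'm, 'h) ecat" and T :: "('p2, 'o2, 'm2, 'h2) ecat" +
  fixes \<Phi> :: "('p, 'o, 'm, 'h, 'p2, 'o2, 'm2, 'h2) efunc"
  assumes eobj_in: "p \<in> EOb S \<Longrightarrow> EFobj \<Phi> p \<in> EOb T"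
    and efcat: "p \<in> EOb S \<Longrightarrow> cat_functor (ECat S p) (ECat T (EFobj \<Phi> p)) (EFcat \<Phi> p)"
    and efhom: "\<lbrakk>p \<in> EOb S; q \<in> EOb S\<rbrakk> \<Longrightarrow>
      prof_square (ECat S p) (ECat S q) (EFcat \<Phi> p) (EFcat \<Phi> q)
        (EHom S p q) (EHom T (EFobj \<Phi> p) (EFobj \<Phi> q)) (EFhom \<Phi> p q)"
    and efunit: "\<lbrakk>p \<in> EOb S; x \<in> Obj (ECat S p); y \<in> Obj (ECat S p); u \<in> Arr (ECat S p) x y\<rbrakk> \<Longrightarrow>
      EFhom \<Phi> p p x y (EUnit S p x y u)
      = EUnit T (EFobj \<Phi> p) (Fobj (EFcat \<Phi> p) x) (Fobj (EFcat \<Phi> p) y) (Fmor (EFcat \<Phi> p) x y u)"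
    and efcomp: "\<lbrakk>p \<in> EOb S; q \<in> EOb S; r \<in> EOb S;
        x \<in> Obj (ECat S p); y \<in> Obj (ECat S q); z \<in> Obj (ECat S r);
        h \<in> Fobj (EHom S p q) (x, y); k \<in> Fobj (EHom S q r) (y, z)\<rbrakk> \<Longrightarrow>
      EFhom \<Phi> p r x z (EComp S p q r x y z h k)
      = EComp T (EFobj \<Phi> p) (EFobj \<Phi> q) (EFobj \<Phi> r)
          (Fobj (EFcat \<Phi> p) x) (Fobj (EFcat \<Phi> q) y) (Fobj (EFcat \<Phi> r) z)
          (EFhom \<Phi> p q x y h) (EFhom \<Phi> q r y z k)"

definition id_efunc :: "('p, 'o, 'm, 'h, 'p, 'o, 'm, 'h) efunc" where
  "id_efunc = \<lparr>EFobj = (\<lambda>p. p), EFcat = (\<lambda>p. id_func), EFhom = (\<lambda>p q x y h. h)\<rparr>"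

definition comp_efunc :: "('p2, 'o2, 'm2, 'h2, 'p3, 'o3, 'm3, 'h3) efunc
    \<Rightarrow> ('p, 'o, 'm, 'h, 'p2, 'o2, 'm2, 'h2) efunc
    \<Rightarrow> ('p, 'o, 'm, 'h, 'p3, 'o3, 'm3, 'h3) efunc" where
  "comp_efunc \<Psi> \<Phi> = \<lparr>EFobj = (\<lambda>p. EFobj \<Psi> (EFobj \<Phi> p)),
     EFcat = (\<lambda>p. comp_func (EFcat \<Psi> (EFobj \<Phi> p)) (EFcat \<Phi> p)),
     EFhom = (\<lambda>p q x y h. EFhom \<Psi> (EFobj \<Phi> p) (EFobj \<Phi> q)
       (Fobj (EFcat \<Phi> p) x) (Fobj (EFcat \<Phi> q) y) (EFhom \<Phi> p q x y h))\<rparr>"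

definition efunc_restrict :: "('p, 'o, 'm, 'h) ecat \<Rightarrow> ('p, 'o, 'm, 'h, 'p2, 'o2, 'm2, 'h2) efunc
    \<Rightarrow> ('p, 'o, 'm, 'h, 'p2, 'o2, 'm2, 'h2) efunc" where
  "efunc_restrict S \<Phi> = \<lparr>EFobj = (\<lambda>p\<in>EOb S. EFobj \<Phi> p),
     EFcat = (\<lambda>p\<in>EOb S. func_restrict (ECat S p) (EFcat \<Phi> p)),
     EFhom = (\<lambda>p\<in>EOb S. \<lambda>q\<in>EOb S. \<lambda>x\<in>Obj (ECat S p). \<lambda>y\<in>Obj (ECat S q).
       \<lambda>h\<in>Fobj (EHom S p q) (x, y). EFhom \<Phi> p q x y h)\<rparr>"

definition Prof_Cat ::
  "(('p, 'o, 'm, 'h) ecat, ('p, 'o, 'm, 'h, 'p, 'o, 'm, 'h) efunc) cat" where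
  "Prof_Cat = \<lparr>Obj = {S. prof_category S},
     Arr = (\<lambda>S T. {\<Phi>. prof_functor S T \<Phi> \<and> efunc_restrict S \<Phi> = \<Phi>}),
     Ident = (\<lambda>S. efunc_restrict S id_efunc),
     Cmp = (\<lambda>S T U \<Psi> \<Phi>. efunc_restrict S (comp_efunc \<Psi> \<Phi>))\<rparr>"

text \<open>Restricting the tight morphisms of the base to a wide, locally full sub-double-category
  leaves the enriched categories unchanged, since the unit and composition squares have identity
  tight boundaries; only the components of enriched functors are constrained.\<close>

definition Prof_bo_Cat ::
  "(('p, 'o, 'm, 'h) ecat, ('p, 'o, 'm, 'h, 'p, 'o, 'm, 'h) efunc) cat" where
  "Prof_bo_Cat = wide_subcat Prof_Cat
     (\<lambda>S T \<Phi>. \<forall>p\<in>EOb S. bij_on_objects (ECat S p) (ECat T (EFobj \<Phi> p)) (EFcat \<Phi> p))"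

definition Prof_ff_Cat ::
  "(('p, 'o, 'm, 'h) ecat, ('p, 'o, 'm, 'h, 'p, 'o, 'm, 'h) efunc) cat" where
  "Prof_ff_Cat = wide_subcat Prof_Cat
     (\<lambda>S T \<Phi>. \<forall>p\<in>EOb S. fully_faithful (ECat S p) (ECat T (EFobj \<Phi> p)) (EFcat \<Phi> p))"

text \<open>The coproduct of the representables \<open>Set(A i, -)\<close> over \<open>i \<in> I\<close> is given by the family
  \<open>(A i)\<close> indexed by \<open>I\<close>, encoded as a partial map with domain \<open>I\<close>;
  \<open>poly_ap\<close> and \<open>poly_map\<close> are its action on sets and functions.\<close>

type_synonym ('i, 'a) poly = "'i \<rightharpoonup> 'a set"

definition positions :: "('i, 'a) poly \<Rightarrow> 'i set" where
  "positions p = dom p"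

definition directions :: "('i, 'a) poly \<Rightarrow> 'i \<Rightarrow> 'a set" where
  "directions p i = the (p i)"

definition poly_ap :: "('i, 'a) poly \<Rightarrow> 'x set \<Rightarrow> ('i \<times> ('a \<Rightarrow> 'x)) set" where
  "poly_ap p X = (SIGMA i:positions p. directions p i \<rightarrow>\<^sub>E X)"

definition poly_map :: "('i, 'a) poly \<Rightarrow> ('x \<Rightarrow> 'y) \<Rightarrow> 'i \<times> ('a \<Rightarrow> 'x) \<Rightarrow> 'i \<times> ('a \<Rightarrow> 'y)" where
  "poly_map p f = (\<lambda>(i, c). (i, \<lambda>a\<in>directions p i. f (c a)))"

type_synonym ('i, 'a, 'o) sobj = "'i \<times> ('a \<Rightarrow> 'o)"
type_synonym ('a, 'm) smor = "('a \<Rightarrow> 'a) \<times> ('a \<Rightarrow> 'm)"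

definition sel_obj :: "('o, 'm) cat \<Rightarrow> ('i, 'a) poly \<Rightarrow> ('i, 'a, 'o) sobj set" where
  "sel_obj C p = poly_ap p (Obj C)"

text \<open>Elements of \<open>\<Prod>b. \<Sum>a. C(c a, d b)\<close>, as pairs of a map \<open>\<phi>\<close> choosing \<open>a\<close> for each \<open>b\<close> and a
  family of morphisms \<open>c (\<phi> b) \<rightarrow> d b\<close>.  The case \<open>p = q\<close> gives the morphisms of the selection
  category of \<open>p\<close>.\<close>

definition sel_hom :: "('o, 'm) cat \<Rightarrow> ('i, 'a) poly \<Rightarrow> ('i, 'a) poly
    \<Rightarrow> ('i, 'a, 'o) sobj \<Rightarrow> ('i, 'a, 'o) sobj \<Rightarrow> ('a, 'm) smor set" where
  "sel_hom C p q = (\<lambda>(i, c) (j, d).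
     SIGMA \<phi>:(directions q j \<rightarrow>\<^sub>E directions p i).
       (\<Pi>\<^sub>E b\<in>directions q j. Arr C (c (\<phi> b)) (d b)))"

definition sel_ident :: "('o, 'm) cat \<Rightarrow> ('i, 'a) poly \<Rightarrow> ('i, 'a, 'o) sobj \<Rightarrow> ('a, 'm) smor" where
  "sel_ident C p = (\<lambda>(i, c). (\<lambda>a\<in>directions p i. a, \<lambda>a\<in>directions p i. Ident C (c a)))"

text \<open>The composite of \<open>(\<phi>, f) : (i, c) \<rightarrow> (j, d)\<close> followed by \<open>(\<psi>, g) : (j, d) \<rightarrow> (k, e)\<close>, where
  \<open>r\<close> is the polynomial of which \<open>k\<close> is a position.\<close>

definition sel_cmp :: "('o, 'm) cat \<Rightarrow> ('i, 'a) poly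
    \<Rightarrow> ('i, 'a, 'o) sobj \<Rightarrow> ('i, 'a, 'o) sobj \<Rightarrow> ('i, 'a, 'o) sobj
    \<Rightarrow> ('a, 'm) smor \<Rightarrow> ('a, 'm) smor \<Rightarrow> ('a, 'm) smor" where
  "sel_cmp C r = (\<lambda>(i, c) (j, d) (k, e) (\<psi>, g) (\<phi>, f).
     (\<lambda>b\<in>directions r k. \<phi> (\<psi> b),
      \<lambda>b\<in>directions r k. Cmp C (c (\<phi> (\<psi> b))) (d (\<psi> b)) (e b) (g b) (f (\<psi> b))))"

definition sel_cat :: "('o, 'm) cat \<Rightarrow> ('i, 'a) poly
    \<Rightarrow> (('i, 'a, 'o) sobj, ('a, 'm) smor) cat" where
  "sel_cat C p = \<lparr>Obj = sel_obj C p, Arr = sel_hom C p p, Ident = sel_ident C p,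
     Cmp = sel_cmp C p\<rparr>"

definition sel_prof :: "('o, 'm) cat \<Rightarrow> ('i, 'a) poly \<Rightarrow> ('i, 'a) poly
    \<Rightarrow> (('i, 'a, 'o) sobj, ('a, 'm) smor, ('i, 'a, 'o) sobj, ('a, 'm) smor, ('a, 'm) smor) prof" where
  "sel_prof C p q = \<lparr>Fobj = (\<lambda>(x, y). sel_hom C p q x y),
     Fmor = (\<lambda>(x, y) (x', y') (u, v). \<lambda>h\<in>sel_hom C p q x y.
       sel_cmp C q x' y y' v (sel_cmp C q x' x y h u))\<rparr>"

definition sel_ecat :: "('o, 'm) cat
    \<Rightarrow> (('i, 'a) poly, ('i, 'a, 'o) sobj, ('a, 'm) smor, ('a, 'm) smor) ecat" where
  "sel_ecat C = \<lparr>EOb = UNIV, ECat = sel_cat C, EHom = sel_prof C,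
     EUnit = (\<lambda>p x y u. u),
     EComp = (\<lambda>p q r x y z h k. sel_cmp C r x y z k h)\<rparr>"

definition sel_map_obj :: "('i, 'a) poly \<Rightarrow> ('o, 'm, 'o2, 'm2) func
    \<Rightarrow> ('i, 'a, 'o) sobj \<Rightarrow> ('i, 'a, 'o2) sobj" where
  "sel_map_obj p F = poly_map p (Fobj F)"

text \<open>Here \<open>q\<close> is the polynomial of which \<open>j\<close> is a position.\<close>

definition sel_map_hom :: "('i, 'a) poly \<Rightarrow> ('o, 'm, 'o2, 'm2) func
    \<Rightarrow> ('i, 'a, 'o) sobj \<Rightarrow> ('i, 'a, 'o) sobj \<Rightarrow> ('a, 'm) smor \<Rightarrow> ('a, 'm2) smor" where
  "sel_map_hom q F = (\<lambda>(i, c) (j, d) (\<beta>, g).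
     (\<beta>, \<lambda>b\<in>directions q j. Fmor F (c (\<beta> b)) (d b) (g b)))"

definition sel_func :: "('o, 'm) cat \<Rightarrow> ('o, 'm, 'o2, 'm2) func \<Rightarrow> ('i, 'a) poly
    \<Rightarrow> (('i, 'a, 'o) sobj, ('a, 'm) smor, ('i, 'a, 'o2) sobj, ('a, 'm2) smor) func" where
  "sel_func C F p = func_restrict (sel_cat C p)
     \<lparr>Fobj = sel_map_obj p F, Fmor = sel_map_hom p F\<rparr>"

definition sel_efunc :: "('o, 'm) cat \<Rightarrow> ('o, 'm, 'o2, 'm2) func
    \<Rightarrow> (('i, 'a) poly, ('i, 'a, 'o) sobj, ('a, 'm) smor, ('a, 'm) smor,
        ('i, 'a) poly, ('i, 'a, 'o2) sobj, ('a, 'm2) smor, ('a, 'm2) smor) efunc" where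
  "sel_efunc C F = efunc_restrict (sel_ecat C)
     \<lparr>EFobj = (\<lambda>p. p), EFcat = sel_func C F, EFhom = (\<lambda>p q. sel_map_hom q F)\<rparr>"

type_synonym ('i, 'a, 'o, 'm) selecat =
  "(('i, 'a) poly, ('i, 'a, 'o) sobj, ('a, 'm) smor, ('a, 'm) smor) ecat"
type_synonym ('i, 'a, 'o, 'm) selefunc =
  "(('i, 'a) poly, ('i, 'a, 'o) sobj, ('a, 'm) smor, ('a, 'm) smor,
    ('i, 'a) poly, ('i, 'a, 'o) sobj, ('a, 'm) smor, ('a, 'm) smor) efunc"
type_synonym ('i, 'a, 'o, 'm) selfunctor =
  "(('o, 'm) cat, ('o, 'm, 'o, 'm) func, ('i, 'a, 'o, 'm) selecat, ('i, 'a, 'o, 'm) selefunc) func"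

text \<open>Each enriched category \<open>sel_ecat C\<close> has all of \<open>('i, 'a) poly\<close> as objects;
  the types \<open>'i\<close> and \<open>'a\<close> bound the index and exponent sets.\<close>

definition selection :: "('i, 'a, 'o, 'm) selfunctor" where
  "selection = \<lparr>Fobj = sel_ecat, Fmor = (\<lambda>C C' F. sel_efunc C F)\<rparr>"

end

theory Submission
  imports Defs
begin

text \<open>All selection categories and hom profunctors of \<open>\<S>\<^sub>C\<close> are cut out of one category whose
  objects are the triples \<open>(p, i, c)\<close>: composition there is associative and unital because it is so
  in \<open>C\<close>, pointwise in the directions, and the axioms of an enriched category and of an enriched
  functor are all instances of this.  If \<open>F\<close> is bijective on objects or fully faithful, then
  composing with the inverse of its object map, respectively of its maps on hom-sets, inverts
  \<open>\<S>\<^sub>F(p)\<close>.\<close>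

section \<open>Categories and functors\<close>

lemma func_restrict_simps [simp]:
  "x \<in> Obj C \<Longrightarrow> Fobj (func_restrict C F) x = Fobj F x"
  "\<lbrakk>x \<in> Obj C; y \<in> Obj C; f \<in> Arr C x y\<rbrakk> \<Longrightarrow> Fmor (func_restrict C F) x y f = Fmor F x y f"
  by (auto simp: func_restrict_def)

lemma id_func_simps [simp]: "Fobj id_func x = x" "Fmor id_func x y f = f"
  by (auto simp: id_func_def)

lemma comp_func_simps [simp]:
  "Fobj (comp_func G F) x = Fobj G (Fobj F x)"
  "Fmor (comp_func G F) x y f = Fmor G (Fobj F x) (Fobj F y) (Fmor F x y f)"
  by (auto simp: comp_func_def)

text \<open>Arrows of \<open>Cat\<close> are restricted records, so an equation between them reduces
  to agreement on the objects and arrows of \<open>C\<close>.\<close>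

lemma func_restrict_cong:
  assumes "\<And>x. x \<in> Obj C \<Longrightarrow> Fobj F x = Fobj G x"
    and "\<And>x y f. \<lbrakk>x \<in> Obj C; y \<in> Obj C; f \<in> Arr C x y\<rbrakk> \<Longrightarrow> Fmor F x y f = Fmor G x y f"
  shows "func_restrict C F = func_restrict C G"
  unfolding func_restrict_def using assms by (auto intro!: restrict_ext)

lemma func_restrict_idem [simp]: "func_restrict C (func_restrict C F) = func_restrict C F"
  by (rule func_restrict_cong) auto

lemma cat_functor_restrict:
  assumes "cat_functor C D F"
  shows "cat_functor C D (func_restrict C F)"
proof -
  interpret cat_functor C D F by fact
  show ?thesis
    by unfold_locales (auto simp: C.ident_in C.cmp_in obj_in mor_in mor_ident mor_cmp)
qed

lemma cat_functor_id: "category C \<Longrightarrow> cat_functor C C id_func"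
  by (simp add: cat_functor_def cat_functor_axioms_def)

lemma cat_functor_comp:
  assumes "cat_functor C D F" "cat_functor D E G"
  shows "cat_functor C E (comp_func G F)"
proof -
  interpret F: cat_functor C D F by fact
  interpret G: cat_functor D E G by fact
  show ?thesis
    by unfold_locales
      (auto simp: F.obj_in F.mor_in F.mor_ident F.mor_cmp G.obj_in G.mor_in G.mor_ident G.mor_cmp)
qed

lemma Cat_simps [simp]:
  "C \<in> Obj Cat \<longleftrightarrow> category C"
  "F \<in> Arr Cat C D \<longleftrightarrow> cat_functor C D F \<and> func_restrict C F = F"
  "Ident Cat C = func_restrict C id_func"
  "Cmp Cat C D E G F = func_restrict C (comp_func G F)"
  by (auto simp: Cat_def)

text \<open>Inside its category the restricted identity acts as the identity. In the second equation
  it is evaluated at values of \<open>F\<close>, which lie in \<open>D\<close> because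
  \<open>F\<close> is a functor.\<close>

lemma func_restrict_comp_id:
  assumes "cat_functor C D F"
  shows "func_restrict C (comp_func F (func_restrict C id_func)) = func_restrict C F"
    and "func_restrict C (comp_func (func_restrict D id_func) F) = func_restrict C F"
proof -
  interpret cat_functor C D F by fact
  show "func_restrict C (comp_func F (func_restrict C id_func)) = func_restrict C F"
    and "func_restrict C (comp_func (func_restrict D id_func) F) = func_restrict C F"
    by (rule func_restrict_cong; simp add: obj_in mor_in)+
qed

lemma func_restrict_comp_assoc:
  assumes "cat_functor B C F" "cat_functor C D G"
  shows "func_restrict B (comp_func (func_restrict C (comp_func H G)) F)
    = func_restrict B (comp_func H (func_restrict B (comp_func G F)))"
proof -
  interpret F: cat_functor B C F by fact
  show ?thesis
    by (rule func_restrict_cong) (simp_all add: F.obj_in F.mor_in)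
qed

lemma category_Cat: "category Cat"
proof
  fix x :: "('o, 'm) cat" assume "x \<in> Obj Cat"
  then show "Ident Cat x \<in> Arr Cat x x"
    by (simp add: cat_functor_restrict cat_functor_id)
next
  fix x y z :: "('o, 'm) cat" and f g
  assume "f \<in> Arr Cat x y" "g \<in> Arr Cat y z"
  then show "Cmp Cat x y z g f \<in> Arr Cat x z"
    by (auto intro: cat_functor_restrict cat_functor_comp)
next
  fix x y :: "('o, 'm) cat" and f
  assume "f \<in> Arr Cat x y"
  then show "Cmp Cat x x y f (Ident Cat x) = f" "Cmp Cat x y y (Ident Cat y) f = f"
    by (auto simp: func_restrict_comp_id)
next
  fix w x y z :: "('o, 'm) cat" and f g h
  assume "f \<in> Arr Cat w x" "g \<in> Arr Cat x y" "h \<in> Arr Cat y z"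
  then show "Cmp Cat w x z (Cmp Cat x y z h g) f = Cmp Cat w y z h (Cmp Cat w x y g f)"
    by (auto intro: func_restrict_comp_assoc)
qed

section \<open>Wide subcategories; bijective-on-objects and fully faithful functors\<close>

lemma wide_subcat_simps [simp]:
  "Obj (wide_subcat C P) = Obj C"
  "f \<in> Arr (wide_subcat C P) x y \<longleftrightarrow> f \<in> Arr C x y \<and> P x y f"
  "Ident (wide_subcat C P) = Ident C"
  "Cmp (wide_subcat C P) = Cmp C"
  by (auto simp: wide_subcat_def)

text \<open>All equations are inherited from \<open>C\<close>; only closure of \<open>P\<close>
  under identities and composites has to be supplied.\<close>

lemma category_wide_subcat:
  assumes "category C"
    and ident: "\<And>x. x \<in> Obj C \<Longrightarrow> P x x (Ident C x)"
    and cmp: "\<And>x y z f g. \<lbrakk>x \<in> Obj C; y \<in> Obj C; z \<in> Obj C; f \<in> Arr C x y; g \<in> Arr C y z;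
      P x y f; P y z g\<rbrakk> \<Longrightarrow> P x z (Cmp C x y z g f)"
  shows "category (wide_subcat C P)"
proof -
  interpret category C by fact
  show ?thesis
    by unfold_locales
      (auto simp: ident_in cmp_in cmp_ident_right cmp_ident_left cmp_assoc ident intro: cmp)
qed

text \<open>Both restriction claims of the theorem have this form: once the functor exists on the
  ambient categories, a single condition on arrows remains.\<close>

lemma cat_functor_wide_subcat:
  assumes "cat_functor C D F" "category (wide_subcat C P)" "category (wide_subcat D Q)"
    and "\<And>x y f. \<lbrakk>x \<in> Obj C; y \<in> Obj C; f \<in> Arr C x y; P x y f\<rbrakk>
      \<Longrightarrow> Q (Fobj F x) (Fobj F y) (Fmor F x y f)"
  shows "cat_functor (wide_subcat C P) (wide_subcat D Q) F"
proof -
  interpret F: cat_functor C D F by fact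
  interpret C': category "wide_subcat C P" by fact
  interpret D': category "wide_subcat D Q" by fact
  show ?thesis
    by unfold_locales (auto simp: F.obj_in F.mor_in F.mor_ident F.mor_cmp assms(4))
qed

text \<open>Composition in \<open>Cat\<close> ends with a restriction. Since the property concerns
  values on \<open>Obj C\<close> only, closure under composition may be checked on the unrestricted
  composite.\<close>

lemma bij_on_objects_restrict [simp]:
  "bij_on_objects C D (func_restrict C F) \<longleftrightarrow> bij_on_objects C D F"
  by (simp add: bij_on_objects_def cong: bij_betw_cong)

lemma bij_on_objects_id [simp]: "bij_on_objects C C id_func"
  by (simp add: bij_on_objects_def bij_betw_def inj_on_def)

lemma bij_on_objects_comp:
  "\<lbrakk>bij_on_objects C D F; bij_on_objects D E G\<rbrakk> \<Longrightarrow> bij_on_objects C E (comp_func G F)"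
  using bij_betw_trans[of "Fobj F" "Obj C" "Obj D" "Fobj G" "Obj E"]
  by (simp add: bij_on_objects_def comp_func_def o_def)

lemma fully_faithful_restrict [simp]:
  "fully_faithful C D (func_restrict C F) \<longleftrightarrow> fully_faithful C D F"
proof -
  have "bij_betw (Fmor (func_restrict C F) x y) (Arr C x y) B \<longleftrightarrow> bij_betw (Fmor F x y) (Arr C x y) B"
    if "x \<in> Obj C" "y \<in> Obj C" for x y B
    using that by (intro bij_betw_cong) simp
  then show ?thesis
    by (simp add: fully_faithful_def)
qed

lemma fully_faithful_id [simp]: "fully_faithful C C id_func"
  by (simp add: fully_faithful_def bij_betw_def inj_on_def)

text \<open>Each hom map of the composite is a composite of two bijections. That \<open>F\<close> is
  a functor puts \<open>Fobj F x\<close> and \<open>Fobj F y\<close> in \<open>Obj D\<close>, where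
  full faithfulness of \<open>G\<close> applies.\<close>

lemma fully_faithful_comp:
  assumes "cat_functor C D F" "fully_faithful C D F" "fully_faithful D E G"
  shows "fully_faithful C E (comp_func G F)"
  unfolding fully_faithful_def
proof (intro ballI)
  fix x y assume "x \<in> Obj C" "y \<in> Obj C"
  then show "bij_betw (Fmor (comp_func G F) x y) (Arr C x y)
      (Arr E (Fobj (comp_func G F) x) (Fobj (comp_func G F) y))"
    using assms bij_betw_trans[of "Fmor F x y" "Arr C x y" "Arr D (Fobj F x) (Fobj F y)"
        "Fmor G (Fobj F x) (Fobj F y)"]
    by (simp add: fully_faithful_def cat_functor.obj_in o_def comp_func_def)
qed

lemma category_Cat_bo: "category Cat_bo"
  unfolding Cat_bo_def
  by (rule category_wide_subcat[OF category_Cat]) (auto intro: bij_on_objects_comp)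

lemma category_Cat_ff: "category Cat_ff"
  unfolding Cat_ff_def
  by (rule category_wide_subcat[OF category_Cat]) (auto intro: fully_faithful_comp)

section \<open>Profunctors\<close>

lemma category_op_cat:
  assumes "category C"
  shows "category (op_cat C)"
proof -
  interpret category C by fact
  show ?thesis
    by unfold_locales (auto simp: op_cat_def ident_in cmp_in cmp_ident_right cmp_ident_left cmp_assoc)
qed

lemma category_prod_cat:
  assumes "category C" "category D"
  shows "category (prod_cat C D)"
proof -
  interpret C: category C by fact
  interpret D: category D by fact
  show ?thesis
    by unfold_locales
      (auto simp: prod_cat_def C.ident_in C.cmp_in C.cmp_ident_right C.cmp_ident_left C.cmp_assoc
        D.ident_in D.cmp_in D.cmp_ident_right D.cmp_ident_left D.cmp_assoc)
qed

text \<open>Arrows are extensional functions, so two of them that agree on the domain are equal and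
  the laws hold as literal equalities.\<close>

lemma category_set_cat: "category set_cat"
  by unfold_locales (auto simp: set_cat_def compose_def fun_eq_iff PiE_def extensional_def Pi_def)

lemma profunctor_act_in:
  assumes "profunctor C D P" "x \<in> Obj C" "x' \<in> Obj C" "y \<in> Obj D" "y' \<in> Obj D"
    "u \<in> Arr C x' x" "v \<in> Arr D y y'" "h \<in> Fobj P (x, y)"
  shows "Fmor P (x, y) (x', y') (u, v) h \<in> Fobj P (x', y')"
proof -
  have "Fmor P (x, y) (x', y') (u, v) \<in> Arr set_cat (Fobj P (x, y)) (Fobj P (x', y'))"
    using assms unfolding profunctor_def
    by (intro cat_functor.mor_in) (auto simp: prod_cat_def op_cat_def)
  with assms(8) show ?thesis by (auto simp: set_cat_def)
qed

section \<open>Squares between profunctors\<close>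

lemma prof_squareI:
  assumes "\<And>x y h. \<lbrakk>x \<in> Obj C; y \<in> Obj D; h \<in> Fobj P (x, y)\<rbrakk>
      \<Longrightarrow> \<alpha> x y h \<in> Fobj Q (Fobj F x, Fobj G y)"
    and "\<And>x x' y y' u v h. \<lbrakk>x \<in> Obj C; x' \<in> Obj C; y \<in> Obj D; y' \<in> Obj D;
        u \<in> Arr C x' x; v \<in> Arr D y y'; h \<in> Fobj P (x, y)\<rbrakk>
      \<Longrightarrow> \<alpha> x' y' (Fmor P (x, y) (x', y') (u, v) h)
        = Fmor Q (Fobj F x, Fobj G y) (Fobj F x', Fobj G y')
             (Fmor F x' x u, Fmor G y y' v) (\<alpha> x y h)"
  shows "prof_square C D F G P Q \<alpha>"
  using assms by (simp add: prof_square_def)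

lemma prof_squareD:
  assumes "prof_square C D F G P Q \<alpha>"
  shows "\<lbrakk>x \<in> Obj C; y \<in> Obj D; h \<in> Fobj P (x, y)\<rbrakk> \<Longrightarrow> \<alpha> x y h \<in> Fobj Q (Fobj F x, Fobj G y)"
    and "\<lbrakk>x \<in> Obj C; x' \<in> Obj C; y \<in> Obj D; y' \<in> Obj D;
        u \<in> Arr C x' x; v \<in> Arr D y y'; h \<in> Fobj P (x, y)\<rbrakk>
      \<Longrightarrow> \<alpha> x' y' (Fmor P (x, y) (x', y') (u, v) h)
        = Fmor Q (Fobj F x, Fobj G y) (Fobj F x', Fobj G y')
             (Fmor F x' x u, Fmor G y y' v) (\<alpha> x y h)"
  using assms by (simp_all add: prof_square_def)

text \<open>A square uses its functors and its map only inside \<open>C\<close>, \<open>D\<close>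
  and \<open>P\<close>. That \<open>P\<close> is a profunctor keeps the transported element in
  \<open>P\<close>, where \<open>\<alpha>'\<close> agrees with \<open>\<alpha>\<close>.\<close>

lemma prof_square_cong:
  assumes "prof_square C D F G P Q \<alpha>" "profunctor C D P"
    and "func_restrict C F' = func_restrict C F" "func_restrict D G' = func_restrict D G"
    and "\<And>x y h. \<lbrakk>x \<in> Obj C; y \<in> Obj D; h \<in> Fobj P (x, y)\<rbrakk> \<Longrightarrow> \<alpha>' x y h = \<alpha> x y h"
  shows "prof_square C D F' G' P Q \<alpha>'"
proof -
  have obj: "x \<in> Obj C \<Longrightarrow> Fobj F' x = Fobj F x" "y \<in> Obj D \<Longrightarrow> Fobj G' y = Fobj G y" for x y
    by (metis assms(3) func_restrict_simps(1), metis assms(4) func_restrict_simps(1))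
  have mor: "\<lbrakk>x \<in> Obj C; x' \<in> Obj C; u \<in> Arr C x x'\<rbrakk> \<Longrightarrow> Fmor F' x x' u = Fmor F x x' u"
    "\<lbrakk>y \<in> Obj D; y' \<in> Obj D; v \<in> Arr D y y'\<rbrakk> \<Longrightarrow> Fmor G' y y' v = Fmor G y y' v" for x x' u y y' v
    by (metis assms(3) func_restrict_simps(2), metis assms(4) func_restrict_simps(2))
  show ?thesis
    by (rule prof_squareI)
      (simp_all add: obj mor assms(5) profunctor_act_in[OF assms(2)]
        prof_squareD[OF assms(1)])
qed

lemma prof_square_id: "prof_square C D id_func id_func P P (\<lambda>x y h. h)"
  by (rule prof_squareI) simp_all

text \<open>Vertical pasting of squares: naturality of \<open>\<beta>\<close> is used at images
  under \<open>F\<close> and \<open>G\<close>, which are objects and arrows of \<open>C'\<close> and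
  \<open>D'\<close>.\<close>

lemma prof_square_comp:
  assumes "prof_square C D F G P Q \<alpha>" "prof_square C' D' F' G' Q R \<beta>"
    "cat_functor C C' F" "cat_functor D D' G"
  shows "prof_square C D (comp_func F' F) (comp_func G' G) P R
    (\<lambda>x y h. \<beta> (Fobj F x) (Fobj G y) (\<alpha> x y h))"
proof -
  interpret F: cat_functor C C' F by fact
  interpret G: cat_functor D D' G by fact
  show ?thesis
    by (rule prof_squareI)
      (simp_all add: F.obj_in F.mor_in G.obj_in G.mor_in
        prof_squareD[OF assms(1)] prof_squareD[OF assms(2)])
qed

section \<open>Enriched categories and enriched functors\<close>

lemma efunc_restrict_simps [simp]:
  "p \<in> EOb S \<Longrightarrow> EFobj (efunc_restrict S \<Phi>) p = EFobj \<Phi> p"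
  "p \<in> EOb S \<Longrightarrow> EFcat (efunc_restrict S \<Phi>) p = func_restrict (ECat S p) (EFcat \<Phi> p)"
  "\<lbrakk>p \<in> EOb S; q \<in> EOb S; x \<in> Obj (ECat S p); y \<in> Obj (ECat S q); h \<in> Fobj (EHom S p q) (x, y)\<rbrakk>
    \<Longrightarrow> EFhom (efunc_restrict S \<Phi>) p q x y h = EFhom \<Phi> p q x y h"
  by (auto simp: efunc_restrict_def)

lemma id_efunc_simps [simp]:
  "EFobj id_efunc p = p" "EFcat id_efunc p = id_func" "EFhom id_efunc p q = (\<lambda>x y h. h)"
  by (auto simp: id_efunc_def)

lemma comp_efunc_simps [simp]:
  "EFobj (comp_efunc \<Psi> \<Phi>) p = EFobj \<Psi> (EFobj \<Phi> p)"
  "EFcat (comp_efunc \<Psi> \<Phi>) p = comp_func (EFcat \<Psi> (EFobj \<Phi> p)) (EFcat \<Phi> p)"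
  "EFhom (comp_efunc \<Psi> \<Phi>) p q x y h = EFhom \<Psi> (EFobj \<Phi> p) (EFobj \<Phi> q)
       (Fobj (EFcat \<Phi> p) x) (Fobj (EFcat \<Phi> q) y) (EFhom \<Phi> p q x y h)"
  by (auto simp: comp_efunc_def)

lemma efunc_restrict_cong:
  assumes "\<And>p. p \<in> EOb S \<Longrightarrow> EFobj \<Phi> p = EFobj \<Psi> p"
    and "\<And>p. p \<in> EOb S \<Longrightarrow>
      func_restrict (ECat S p) (EFcat \<Phi> p) = func_restrict (ECat S p) (EFcat \<Psi> p)"
    and "\<And>p q x y h. \<lbrakk>p \<in> EOb S; q \<in> EOb S; x \<in> Obj (ECat S p); y \<in> Obj (ECat S q);
      h \<in> Fobj (EHom S p q) (x, y)\<rbrakk> \<Longrightarrow> EFhom \<Phi> p q x y h = EFhom \<Psi> p q x y h"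
  shows "efunc_restrict S \<Phi> = efunc_restrict S \<Psi>"
  unfolding efunc_restrict_def using assms by (auto intro!: restrict_ext)

lemma efunc_restrict_idem [simp]:
  "efunc_restrict S (efunc_restrict S \<Phi>) = efunc_restrict S \<Phi>"
  by (rule efunc_restrict_cong) auto

context prof_category
begin

text \<open>Together with \<open>ecomp_in\<close> this provides the side conditions under which a
  restricted \<open>EFhom\<close> may be evaluated at units and composites.\<close>

lemma eunit_in:
  "\<lbrakk>p \<in> EOb S; x \<in> Obj (ECat S p); y \<in> Obj (ECat S p); u \<in> Arr (ECat S p) x y\<rbrakk>
    \<Longrightarrow> EUnit S p x y u \<in> Fobj (EHom S p p) (x, y)"
  using prof_squareD(1)[OF eunit, of p x y u] by (simp add: hom_prof_def)

lemma ecomp_in: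
  "\<lbrakk>p \<in> EOb S; q \<in> EOb S; r \<in> EOb S; x \<in> Obj (ECat S p); y \<in> Obj (ECat S q);
    z \<in> Obj (ECat S r); h \<in> Fobj (EHom S p q) (x, y); k \<in> Fobj (EHom S q r) (y, z)\<rbrakk>
    \<Longrightarrow> EComp S p q r x y z h k \<in> Fobj (EHom S p r) (x, z)"
  using ecomp[of p q r] by (simp add: prof_comp_map_def)

end

context prof_functor
begin

lemma efcat_obj_in:
  "\<lbrakk>p \<in> EOb S; x \<in> Obj (ECat S p)\<rbrakk> \<Longrightarrow> Fobj (EFcat \<Phi> p) x \<in> Obj (ECat T (EFobj \<Phi> p))"
  by (rule cat_functor.obj_in[OF efcat])

lemma efcat_mor_in:
  "\<lbrakk>p \<in> EOb S; x \<in> Obj (ECat S p); y \<in> Obj (ECat S p); u \<in> Arr (ECat S p) x y\<rbrakk>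
    \<Longrightarrow> Fmor (EFcat \<Phi> p) x y u
      \<in> Arr (ECat T (EFobj \<Phi> p)) (Fobj (EFcat \<Phi> p) x) (Fobj (EFcat \<Phi> p) y)"
  by (rule cat_functor.mor_in[OF efcat])

lemma efhom_in:
  "\<lbrakk>p \<in> EOb S; q \<in> EOb S; x \<in> Obj (ECat S p); y \<in> Obj (ECat S q); h \<in> Fobj (EHom S p q) (x, y)\<rbrakk>
    \<Longrightarrow> EFhom \<Phi> p q x y h \<in> Fobj (EHom T (EFobj \<Phi> p) (EFobj \<Phi> q))
      (Fobj (EFcat \<Phi> p) x, Fobj (EFcat \<Phi> q) y)"
  by (rule prof_squareD(1)[OF efhom])

end

text \<open>The axioms evaluate \<open>\<Phi>\<close> only at data of \<open>S\<close>, and the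
  unit, composition and profunctor action of \<open>S\<close> do not lead out of
  \<open>S\<close>.\<close>

lemma prof_functor_restrict:
  assumes "prof_functor S T \<Phi>"
  shows "prof_functor S T (efunc_restrict S \<Phi>)"
proof -
  interpret prof_functor S T \<Phi> by fact
  show ?thesis
  proof (intro prof_functor.intro prof_functor_axioms.intro)
    fix p q assume "p \<in> EOb S" "q \<in> EOb S"
    then show "prof_square (ECat S p) (ECat S q)
        (EFcat (efunc_restrict S \<Phi>) p) (EFcat (efunc_restrict S \<Phi>) q) (EHom S p q)
        (EHom T (EFobj (efunc_restrict S \<Phi>) p) (EFobj (efunc_restrict S \<Phi>) q))
        (EFhom (efunc_restrict S \<Phi>) p q)"
      using prof_square_cong[OF efhom S.ehom] by simp
  qed (simp_all add: S.prof_category_axioms T.prof_category_axioms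
      eobj_in efcat cat_functor_restrict S.eunit_in S.ecomp_in efunit efcomp)
qed

lemma prof_functor_id:
  assumes "prof_category S"
  shows "prof_functor S S id_efunc"
proof -
  interpret prof_category S by fact
  show ?thesis
    by (intro prof_functor.intro prof_functor_axioms.intro)
      (simp_all add: prof_category_axioms ecat cat_functor_id prof_square_id)
qed

lemma prof_functor_comp:
  assumes "prof_functor S T \<Phi>" "prof_functor T U \<Psi>"
  shows "prof_functor S U (comp_efunc \<Psi> \<Phi>)"
proof -
  interpret F: prof_functor S T \<Phi> by fact
  interpret G: prof_functor T U \<Psi> by fact
  show ?thesis
  proof (intro prof_functor.intro prof_functor_axioms.intro)
    fix p q assume pq: "p \<in> EOb S" "q \<in> EOb S"
    show "prof_square (ECat S p) (ECat S q)
        (EFcat (comp_efunc \<Psi> \<Phi>) p) (EFcat (comp_efunc \<Psi> \<Phi>) q) (EHom S p q)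
        (EHom U (EFobj (comp_efunc \<Psi> \<Phi>) p) (EFobj (comp_efunc \<Psi> \<Phi>) q))
        (EFhom (comp_efunc \<Psi> \<Phi>) p q)"
      \<comment> \<open>The square of \<open>\<Phi>\<close> at \<open>p\<close>, \<open>q\<close> is
        pasted with that of \<open>\<Psi>\<close> at the image objects.\<close>
      using prof_square_comp[OF F.efhom[OF pq] G.efhom[OF F.eobj_in F.eobj_in, OF pq]
          F.efcat F.efcat, OF pq]
      by (simp add: comp_efunc_def)
  qed (auto intro: F.S.prof_category_axioms G.T.prof_category_axioms cat_functor_comp F.efcat G.efcat F.eobj_in G.eobj_in
      simp: F.efunit F.efcomp G.efunit G.efcomp F.eobj_in F.efcat_obj_in F.efcat_mor_in F.efhom_in)
qed

lemma Prof_Cat_simps [simp]: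
  "S \<in> Obj Prof_Cat \<longleftrightarrow> prof_category S"
  "\<Phi> \<in> Arr Prof_Cat S T \<longleftrightarrow> prof_functor S T \<Phi> \<and> efunc_restrict S \<Phi> = \<Phi>"
  "Ident Prof_Cat S = efunc_restrict S id_efunc"
  "Cmp Prof_Cat S T U \<Psi> \<Phi> = efunc_restrict S (comp_efunc \<Psi> \<Phi>)"
  by (auto simp: Prof_Cat_def)

lemma efunc_restrict_comp_id:
  assumes "prof_functor S T \<Phi>"
  shows "efunc_restrict S (comp_efunc \<Phi> (efunc_restrict S id_efunc)) = efunc_restrict S \<Phi>"
    and "efunc_restrict S (comp_efunc (efunc_restrict T id_efunc) \<Phi>) = efunc_restrict S \<Phi>"
proof -
  interpret prof_functor S T \<Phi> by fact
  show "efunc_restrict S (comp_efunc \<Phi> (efunc_restrict S id_efunc)) = efunc_restrict S \<Phi>"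
    and "efunc_restrict S (comp_efunc (efunc_restrict T id_efunc) \<Phi>) = efunc_restrict S \<Phi>"
    by (rule efunc_restrict_cong;
        simp add: eobj_in efcat_obj_in efhom_in func_restrict_comp_id[OF efcat])+
qed

lemma efunc_restrict_comp_assoc:
  assumes "prof_functor R S \<Phi>" "prof_functor S T \<Psi>"
  shows "efunc_restrict R (comp_efunc (efunc_restrict S (comp_efunc \<Theta> \<Psi>)) \<Phi>)
    = efunc_restrict R (comp_efunc \<Theta> (efunc_restrict R (comp_efunc \<Psi> \<Phi>)))"
proof -
  interpret F: prof_functor R S \<Phi> by fact
  interpret G: prof_functor S T \<Psi> by fact
  show ?thesis
    by (rule efunc_restrict_cong)
      (simp_all add: F.eobj_in F.efcat_obj_in F.efhom_in
        func_restrict_comp_assoc[OF F.efcat G.efcat])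
qed

lemma category_Prof_Cat: "category Prof_Cat"
proof
  fix S :: "('p, 'o, 'm, 'h) ecat" assume "S \<in> Obj Prof_Cat"
  then show "Ident Prof_Cat S \<in> Arr Prof_Cat S S"
    by (simp add: prof_functor_restrict prof_functor_id)
next
  fix S T U :: "('p, 'o, 'm, 'h) ecat" and f g
  assume "f \<in> Arr Prof_Cat S T" "g \<in> Arr Prof_Cat T U"
  then show "Cmp Prof_Cat S T U g f \<in> Arr Prof_Cat S U"
    by (auto intro: prof_functor_restrict prof_functor_comp)
next
  fix S T :: "('p, 'o, 'm, 'h) ecat" and f
  assume "f \<in> Arr Prof_Cat S T"
  then show "Cmp Prof_Cat S S T f (Ident Prof_Cat S) = f"
    "Cmp Prof_Cat S T T (Ident Prof_Cat T) f = f"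
    by (auto simp: efunc_restrict_comp_id)
next
  fix R S T U :: "('p, 'o, 'm, 'h) ecat" and f g h
  assume "f \<in> Arr Prof_Cat R S" "g \<in> Arr Prof_Cat S T" "h \<in> Arr Prof_Cat T U"
  then show "Cmp Prof_Cat R S U (Cmp Prof_Cat S T U h g) f
      = Cmp Prof_Cat R T U h (Cmp Prof_Cat R S T g f)"
    by (auto intro: efunc_restrict_comp_assoc)
qed

text \<open>The component at \<open>p\<close> of a composite is the component of the second functor
  at the image of \<open>p\<close> after that of the first at \<open>p\<close>, so closure under
  composition reduces to the case of ordinary functors.\<close>

lemma category_Prof_bo_Cat: "category Prof_bo_Cat"
  unfolding Prof_bo_Cat_def
  by (rule category_wide_subcat[OF category_Prof_Cat])
    (auto intro!: bij_on_objects_comp intro: prof_functor.eobj_in)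

lemma category_Prof_ff_Cat: "category Prof_ff_Cat"
  unfolding Prof_ff_Cat_def
  by (rule category_wide_subcat[OF category_Prof_Cat])
    (auto intro!: fully_faithful_comp intro: prof_functor.eobj_in prof_functor.efcat)

section \<open>Selection categories\<close>

lemma sel_obj_iff [simp]:
  "(i, c) \<in> sel_obj C p \<longleftrightarrow> i \<in> positions p \<and> c \<in> directions p i \<rightarrow>\<^sub>E Obj C"
  by (simp add: sel_obj_def poly_ap_def)

lemma sel_hom_iff [simp]:
  "(\<phi>, f) \<in> sel_hom C p q (i, c) (j, d) \<longleftrightarrow>
    \<phi> \<in> directions q j \<rightarrow>\<^sub>E directions p i \<and> f \<in> (\<Pi>\<^sub>E b\<in>directions q j. Arr C (c (\<phi> b)) (d b))"
  by (simp add: sel_hom_def)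

lemma sel_map_simps [simp]:
  "sel_map_obj p F (i, c) = (i, \<lambda>a\<in>directions p i. Fobj F (c a))"
  "sel_map_hom q F (i, c) (j, d) (\<beta>, g) = (\<beta>, \<lambda>b\<in>directions q j. Fmor F (c (\<beta> b)) (d b) (g b))"
  by (simp_all add: sel_map_obj_def poly_map_def sel_map_hom_def)

lemma sel_cat_simps [simp]:
  "Obj (sel_cat C p) = sel_obj C p" "Arr (sel_cat C p) = sel_hom C p p"
  "Ident (sel_cat C p) = sel_ident C p" "Cmp (sel_cat C p) = sel_cmp C p"
  by (simp_all add: sel_cat_def)

lemma sel_ecat_simps [simp]:
  "EOb (sel_ecat C) = UNIV" "ECat (sel_ecat C) = sel_cat C" "EHom (sel_ecat C) = sel_prof C"
  "EUnit (sel_ecat C) p x y u = u" "EComp (sel_ecat C) p q r x y z h k = sel_cmp C r x y z k h"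
  by (simp_all add: sel_ecat_def)

lemma Fobj_sel_prof [simp]: "Fobj (sel_prof C p q) (x, y) = sel_hom C p q x y"
  by (simp add: sel_prof_def)

lemma Fmor_sel_prof [simp]:
  "h \<in> sel_hom C p q x y \<Longrightarrow> Fmor (sel_prof C p q) (x, y) (x', y') (u, v) h
    = sel_cmp C q x' y y' v (sel_cmp C q x' x y h u)"
  by (simp add: sel_prof_def)

section \<open>Composition of selection morphisms and the enriched category of
  \<open>C\<close>\<close>

context category
begin

lemma sel_ident_in:
  "x \<in> sel_obj C p \<Longrightarrow> sel_ident C p x \<in> sel_hom C p p x x"
  by (cases x) (auto simp: sel_ident_def ident_in PiE_iff)

text \<open>Three independent polynomials let the same facts serve composition in a selection
  category, the profunctor action and the enriched composition.\<close>

lemma sel_cmp_in: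
  assumes "x \<in> sel_obj C p" "y \<in> sel_obj C q" "z \<in> sel_obj C r"
    "f \<in> sel_hom C p q x y" "g \<in> sel_hom C q r y z"
  shows "sel_cmp C r x y z g f \<in> sel_hom C p r x z"
  using assms
  by (cases x; cases y; cases z; cases f; cases g)
    (auto simp: sel_cmp_def PiE_iff intro!: cmp_in)

text \<open>At each direction of the target this is the unit law of \<open>C\<close>; the index map
  and the family are extensional, so restricting them to the directions returns them
  unchanged.\<close>

lemma sel_cmp_ident_right:
  assumes "x \<in> sel_obj C p" "y \<in> sel_obj C q" "f \<in> sel_hom C p q x y"
  shows "sel_cmp C q x x y f (sel_ident C p x) = f"
  using assms
  by (cases x; cases y; cases f)
    (auto simp: sel_cmp_def sel_ident_def PiE_iff cmp_ident_right fun_eq_iff extensional_def)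

lemma sel_cmp_ident_left:
  assumes "x \<in> sel_obj C p" "y \<in> sel_obj C q" "f \<in> sel_hom C p q x y"
  shows "sel_cmp C q x y y (sel_ident C q y) f = f"
  using assms
  by (cases x; cases y; cases f)
    (auto simp: sel_cmp_def sel_ident_def PiE_iff cmp_ident_left fun_eq_iff extensional_def)

text \<open>Let \<open>\<psi>\<close> and \<open>\<chi>\<close> be the index maps of
  \<open>g\<close> and \<open>h\<close>. At a direction \<open>b\<close> of \<open>z\<close> the
  claim is associativity in \<open>C\<close> for the components of \<open>f\<close> at
  \<open>\<psi> (\<chi> b)\<close>, of \<open>g\<close> at \<open>\<chi> b\<close> and of
  \<open>h\<close> at \<open>b\<close>.\<close>

lemma sel_cmp_assoc:
  assumes "w \<in> sel_obj C p" "x \<in> sel_obj C q" "y \<in> sel_obj C r" "z \<in> sel_obj C s"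
    "f \<in> sel_hom C p q w x" "g \<in> sel_hom C q r x y" "h \<in> sel_hom C r s y z"
  shows "sel_cmp C s w x z (sel_cmp C s x y z h g) f
    = sel_cmp C s w y z h (sel_cmp C r w x y g f)"
  using assms
  by (cases w; cases x; cases y; cases z; cases f; cases g; cases h)
    (auto simp: sel_cmp_def PiE_iff fun_eq_iff intro!: cmp_assoc)

lemma sel_act_in:
  assumes "x \<in> sel_obj C p" "x' \<in> sel_obj C p" "y \<in> sel_obj C q" "y' \<in> sel_obj C q"
    "u \<in> sel_hom C p p x' x" "v \<in> sel_hom C q q y y'" "h \<in> sel_hom C p q x y"
  shows "sel_cmp C q x' y y' v (sel_cmp C q x' x y h u) \<in> sel_hom C p q x' y'"
  using assms by (blast intro: sel_cmp_in)

lemma category_sel_cat: "category (sel_cat C p)"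
  by unfold_locales
    \<comment> \<open>\<open>sel_cmp\<close> takes only the polynomial of the target as an argument,
      so those of intermediate objects, needed for the membership hypotheses, are supplied
      explicitly.\<close>
    (simp_all add: sel_ident_in sel_cmp_in[where q = p] sel_cmp_ident_right sel_cmp_ident_left
      sel_cmp_assoc[where q = p and r = p])

lemma profunctor_sel_prof: "profunctor (sel_cat C p) (sel_cat C q) (sel_prof C p q)"
proof -
  interpret P: category "prod_cat (op_cat (sel_cat C p)) (sel_cat C q)"
    by (intro category_prod_cat category_op_cat category_sel_cat)
  interpret S: category set_cat by (rule category_set_cat)
  show ?thesis
    unfolding profunctor_def
  proof
    fix X Y f
    assume "X \<in> Obj (prod_cat (op_cat (sel_cat C p)) (sel_cat C q))"
      "Y \<in> Obj (prod_cat (op_cat (sel_cat C p)) (sel_cat C q))"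
      "f \<in> Arr (prod_cat (op_cat (sel_cat C p)) (sel_cat C q)) X Y"
    moreover obtain x y x' y' u v where "X = (x, y)" "Y = (x', y')" "f = (u, v)"
      by (metis surj_pair)
    ultimately show "Fmor (sel_prof C p q) X Y f
        \<in> Arr set_cat (Fobj (sel_prof C p q) X) (Fobj (sel_prof C p q) Y)"
      by (simp add: sel_prof_def set_cat_def prod_cat_def op_cat_def restrict_PiE_iff sel_act_in)
  next
    fix X
    assume "X \<in> Obj (prod_cat (op_cat (sel_cat C p)) (sel_cat C q))"
    then show "Fmor (sel_prof C p q) X X (Ident (prod_cat (op_cat (sel_cat C p)) (sel_cat C q)) X)
        = Ident set_cat (Fobj (sel_prof C p q) X)"
      by (cases X)
        (auto simp: sel_prof_def set_cat_def prod_cat_def op_cat_def sel_cmp_ident_left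
          sel_cmp_ident_right intro!: restrict_ext)
  next
    fix X Y Z f g
    assume *: "X \<in> Obj (prod_cat (op_cat (sel_cat C p)) (sel_cat C q))"
      "Y \<in> Obj (prod_cat (op_cat (sel_cat C p)) (sel_cat C q))"
      "Z \<in> Obj (prod_cat (op_cat (sel_cat C p)) (sel_cat C q))"
      "f \<in> Arr (prod_cat (op_cat (sel_cat C p)) (sel_cat C q)) X Y"
      "g \<in> Arr (prod_cat (op_cat (sel_cat C p)) (sel_cat C q)) Y Z"
    obtain x y x' y' x'' y'' u v u' v' where eq: "X = (x, y)" "Y = (x', y')" "Z = (x'', y'')"
      "f = (u, v)" "g = (u', v')"
      by (metis surj_pair)
    have o: "x \<in> sel_obj C p" "x' \<in> sel_obj C p" "x'' \<in> sel_obj C p"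
      "y \<in> sel_obj C q" "y' \<in> sel_obj C q" "y'' \<in> sel_obj C q"
      and m: "u \<in> sel_hom C p p x' x" "u' \<in> sel_hom C p p x'' x'"
      "v \<in> sel_hom C q q y y'" "v' \<in> sel_hom C q q y' y''"
      using * by (simp_all add: eq prod_cat_def op_cat_def)
    \<comment> \<open>Both sides compose \<open>u'\<close>, \<open>u\<close>, \<open>h\<close>,
      \<open>v\<close>, \<open>v'\<close> in this order with different bracketings. The three
      instances of associativity have the profunctor element, the only factor from \<open>p\<close>
      to \<open>q\<close>, as last, middle or first factor.\<close>
    have "sel_cmp C q x'' y y'' (sel_cmp C q y y' y'' v' v)
          (sel_cmp C q x'' x y h (sel_cmp C p x'' x' x u u'))
        = sel_cmp C q x'' y' y'' v' (sel_cmp C q x'' x' y'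
            (sel_cmp C q x' y y' v (sel_cmp C q x' x y h u)) u')"
      if "h \<in> sel_hom C p q x y" for h
      using that o m
      by (simp add: sel_cmp_assoc[of _ p _ p _ p _ q] sel_cmp_assoc[of _ p _ p _ q _ q]
          sel_cmp_assoc[of _ p _ q _ q _ q] sel_cmp_in[of _ p _ p _ p] sel_cmp_in[of _ p _ p _ q]
          sel_cmp_in[of _ p _ q _ q])
    then show "Fmor (sel_prof C p q) X Z
          (Cmp (prod_cat (op_cat (sel_cat C p)) (sel_cat C q)) X Y Z g f)
        = Cmp set_cat (Fobj (sel_prof C p q) X) (Fobj (sel_prof C p q) Y) (Fobj (sel_prof C p q) Z)
            (Fmor (sel_prof C p q) Y Z g) (Fmor (sel_prof C p q) X Y f)"
      by (auto simp: eq sel_prof_def set_cat_def prod_cat_def op_cat_def compose_def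
          sel_act_in o m intro!: restrict_ext)
  qed (simp add: set_cat_def)
qed

lemma prof_category_sel_ecat: "prof_category (sel_ecat C :: ('i, 'a, 'o, 'm) selecat)"
proof (rule prof_category.intro)
  fix p :: "('i, 'a) poly"
  show "prof_square (ECat (sel_ecat C) p) (ECat (sel_ecat C) p) id_func id_func
      (hom_prof (ECat (sel_ecat C) p)) (EHom (sel_ecat C) p p) (EUnit (sel_ecat C) p)"
    \<comment> \<open>The hom profunctor of the selection category and \<open>sel_prof C p p\<close>
      have the same elements and the same action, so the identity map is a square.\<close>
    by (rule prof_squareI) (simp_all add: hom_prof_def)
next
  fix p q r :: "('i, 'a) poly"
  show "prof_comp_map (ECat (sel_ecat C) p) (ECat (sel_ecat C) q) (ECat (sel_ecat C) r)
      (EHom (sel_ecat C) p q) (EHom (sel_ecat C) q r) (EHom (sel_ecat C) p r)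
      (EComp (sel_ecat C) p q r)"
    unfolding prof_comp_map_def
    apply (intro conjI ballI)
    subgoal by (simp add: sel_cmp_in[where q = q])
    \<comment> \<open>Naturality in the outer variables: after the inserted identities are removed,
      both sides compose \<open>u\<close>, \<open>h\<close>, \<open>k\<close>,
      \<open>w\<close>.\<close>
    subgoal
      by (simp add: sel_cmp_ident_left sel_cmp_ident_right sel_cmp_in[of _ p _ p _ q]
          sel_cmp_in[of _ p _ q _ r] sel_cmp_in[of _ q _ r _ r]
          sel_cmp_assoc[of _ p _ p _ q _ r] sel_cmp_assoc[of _ p _ q _ r _ r])
    \<comment> \<open>Dinaturality in the middle variable: \<open>v\<close> may be absorbed into
      \<open>h\<close> or into \<open>k\<close>, by associativity.\<close>
    subgoal
      by (simp add: sel_cmp_ident_left sel_cmp_ident_right sel_cmp_in[of _ p _ q _ q]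
          sel_cmp_in[of _ q _ q _ r] sel_cmp_assoc[of _ p _ q _ q _ r])
    done
  fix x y and z :: "('i, 'a, 'o) sobj" and u h
  assume "x \<in> Obj (ECat (sel_ecat C) p)" "y \<in> Obj (ECat (sel_ecat C) p)"
    "z \<in> Obj (ECat (sel_ecat C) q)" "u \<in> Arr (ECat (sel_ecat C) p) x y"
    "h \<in> Fobj (EHom (sel_ecat C) p q) (y, z)"
  then show "EComp (sel_ecat C) p p q x y z (EUnit (sel_ecat C) p x y u) h
      = Fmor (EHom (sel_ecat C) p q) (y, z) (x, z) (u, Ident (ECat (sel_ecat C) q) z) h"
    \<comment> \<open>The action on the right composes \<open>h\<close> after \<open>u\<close> and
      then with an identity; membership of the composite lets the unit law remove that
      identity.\<close>
    by (simp add: sel_cmp_in[of _ p _ p _ q] sel_cmp_ident_left)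
qed (simp_all add: category_sel_cat profunctor_sel_prof sel_cmp_ident_right sel_cmp_assoc)

end

section \<open>The enriched functor induced by \<open>F\<close> and its components\<close>

context cat_functor
begin

lemma sel_map_obj_in: "x \<in> sel_obj C p \<Longrightarrow> sel_map_obj p F x \<in> sel_obj D p"
  by (cases x) (auto simp: PiE_iff obj_in)

lemma sel_map_hom_in:
  assumes "x \<in> sel_obj C p" "y \<in> sel_obj C q" "f \<in> sel_hom C p q x y"
  shows "sel_map_hom q F x y f \<in> sel_hom D p q (sel_map_obj p F x) (sel_map_obj q F y)"
  using assms
  by (cases x; cases y; cases f) (auto simp: PiE_iff intro!: mor_in)

lemma sel_map_hom_ident:
  assumes "x \<in> sel_obj C p"
  shows "sel_map_hom p F x x (sel_ident C p x) = sel_ident D p (sel_map_obj p F x)"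
  using assms
  by (cases x) (auto simp: sel_ident_def PiE_iff mor_ident intro!: restrict_ext)

text \<open>\<open>F\<close> leaves index maps alone, so the claim is \<open>mor_cmp\<close> at each
  direction of the target. With three polynomials it yields functoriality of the components,
  naturality of the squares and compatibility with enriched composition.\<close>

lemma sel_map_hom_cmp:
  assumes "x \<in> sel_obj C p" "y \<in> sel_obj C q" "z \<in> sel_obj C r"
    "f \<in> sel_hom C p q x y" "g \<in> sel_hom C q r y z"
  shows "sel_map_hom r F x z (sel_cmp C r x y z g f)
    = sel_cmp D r (sel_map_obj p F x) (sel_map_obj q F y) (sel_map_obj r F z)
        (sel_map_hom r F y z g) (sel_map_hom q F x y f)"
  using assms
  by (cases x; cases y; cases z; cases f; cases g)
    (auto simp: sel_cmp_def PiE_iff intro!: restrict_ext mor_cmp)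

lemma cat_functor_sel_func: "cat_functor (sel_cat C p) (sel_cat D p) (sel_func C F p)"
  unfolding sel_func_def
proof (rule cat_functor_restrict)
  interpret C': category "sel_cat C p" by (rule C.category_sel_cat)
  interpret D': category "sel_cat D p" by (rule D.category_sel_cat)
  show "cat_functor (sel_cat C p) (sel_cat D p) \<lparr>Fobj = sel_map_obj p F, Fmor = sel_map_hom p F\<rparr>"
    by unfold_locales (simp_all add: sel_map_obj_in sel_map_hom_in sel_map_hom_ident
        sel_map_hom_cmp[where q = p])
qed

lemma prof_functor_sel_efunc: "prof_functor (sel_ecat C) (sel_ecat D) (sel_efunc C F)"
  unfolding sel_efunc_def
proof (rule prof_functor_restrict)
  interpret C': prof_category "sel_ecat C" by (rule C.prof_category_sel_ecat)
  interpret D': prof_category "sel_ecat D" by (rule D.prof_category_sel_ecat)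
  show "prof_functor (sel_ecat C) (sel_ecat D)
      \<lparr>EFobj = \<lambda>p. p, EFcat = sel_func C F, EFhom = \<lambda>p q. sel_map_hom q F\<rparr>"
  proof (intro prof_functor.intro prof_functor_axioms.intro)
    fix p q
    show "prof_square (ECat (sel_ecat C) p) (ECat (sel_ecat C) q)
        (EFcat \<lparr>EFobj = \<lambda>p. p, EFcat = sel_func C F, EFhom = \<lambda>p q. sel_map_hom q F\<rparr> p)
        (EFcat \<lparr>EFobj = \<lambda>p. p, EFcat = sel_func C F, EFhom = \<lambda>p q. sel_map_hom q F\<rparr> q)
        (EHom (sel_ecat C) p q)
        (EHom (sel_ecat D)
          (EFobj \<lparr>EFobj = \<lambda>p. p, EFcat = sel_func C F, EFhom = \<lambda>p q. sel_map_hom q F\<rparr> p)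
          (EFobj \<lparr>EFobj = \<lambda>p. p, EFcat = sel_func C F, EFhom = \<lambda>p q. sel_map_hom q F\<rparr> q))
        (EFhom \<lparr>EFobj = \<lambda>p. p, EFcat = sel_func C F, EFhom = \<lambda>p q. sel_map_hom q F\<rparr> p q)"
      by (rule prof_squareI)
        \<comment> \<open>The action is precomposition with \<open>u\<close> followed by
          postcomposition with \<open>v\<close>; the two instances of \<open>sel_map_hom_cmp\<close>
          treat these in turn.\<close>
        (simp_all add: sel_func_def sel_map_hom_in C.sel_cmp_in[of _ p _ p _ q]
          sel_map_hom_cmp[where p = p and q = p and r = q]
          sel_map_hom_cmp[where p = p and q = q and r = q])
  \<comment> \<open>\<open>sel_func\<close> stays folded at first so that
    \<open>cat_functor_sel_func\<close> applies; the compatibility laws then need it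
    unfolded.\<close>
  qed (simp_all add: C'.prof_category_axioms D'.prof_category_axioms cat_functor_sel_func,
      simp_all add: sel_func_def sel_map_hom_cmp)
qed

lemma bij_on_objects_sel_func:
  assumes "bij_on_objects C D F"
  shows "bij_on_objects (sel_cat C p) (sel_cat D p) (sel_func C F p)"
proof -
  let ?G = "inv_into (Obj C) (Fobj F)"
  have bij: "bij_betw (Fobj F) (Obj C) (Obj D)"
    using assms by (simp add: bij_on_objects_def)
  note inv = bij_betw_inv_into_left[OF bij] bij_betw_inv_into_right[OF bij]
    bij_betw_apply[OF bij_betw_inv_into[OF bij]]
  have "bij_betw (sel_map_obj p F) (sel_obj C p) (sel_obj D p)"
    \<comment> \<open>The position is fixed and each object of the family is replaced by its
      preimage; restriction to the directions makes the new family extensional.\<close>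
    by (rule bij_betw_byWitness
        [where f' = "\<lambda>(i, d). (i, \<lambda>a\<in>directions p i. ?G (d a))"])
      (auto simp: PiE_iff inv obj_in fun_eq_iff extensional_def)
  then show ?thesis
    \<comment> \<open>The restriction in \<open>sel_func\<close> is removed before
      \<open>bij_on_objects\<close> is unfolded.\<close>
    by (simp add: sel_func_def) (simp add: bij_on_objects_def)
qed

text \<open>Both hom-sets are sums over the same index maps \<open>\<phi>\<close> of products of
  hom-sets. On the factor at \<open>b\<close> the map is that of \<open>F\<close> from
  \<open>c (\<phi> b)\<close> to \<open>d b\<close>, a bijection since both are objects of
  \<open>C\<close>.\<close>

lemma fully_faithful_sel_func:
  assumes "fully_faithful C D F"
  shows "fully_faithful (sel_cat C p) (sel_cat D p) (sel_func C F p)"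
proof -
  have bij: "bij_betw (Fmor F x y) (Arr C x y) (Arr D (Fobj F x) (Fobj F y))"
    if "x \<in> Obj C" "y \<in> Obj C" for x y
    using assms that by (simp add: fully_faithful_def)
  note inv = bij_betw_inv_into_left[OF bij] bij_betw_inv_into_right[OF bij]
    bij_betw_apply[OF bij_betw_inv_into[OF bij]]
  have "bij_betw (sel_map_hom p F (i, c) (j, d)) (sel_hom C p p (i, c) (j, d))
      (sel_hom D p p (sel_map_obj p F (i, c)) (sel_map_obj p F (j, d)))"
    if "(i, c) \<in> sel_obj C p" "(j, d) \<in> sel_obj C p" for i c j d
    using that
    by (intro bij_betw_byWitness[where f' = "\<lambda>(\<phi>, g). (\<phi>, \<lambda>b\<in>directions p j.
        inv_into (Arr C (c (\<phi> b)) (d b)) (Fmor F (c (\<phi> b)) (d b)) (g b))"])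
      (auto simp: PiE_iff inv mor_in fun_eq_iff extensional_def)
  then show ?thesis
    by (simp add: sel_func_def) (auto simp: fully_faithful_def)
qed

end

section \<open>Functoriality of \<open>selection\<close> and its two restrictions\<close>

lemma selection_simps [simp]:
  "Fobj selection C = sel_ecat C" "Fmor selection C C' F = sel_efunc C F"
  by (simp_all add: selection_def)

text \<open>No side conditions arise, because every polynomial is an object of
  \<open>sel_ecat C\<close> and \<open>sel_func\<close> is already restricted.\<close>

lemma sel_efunc_simps [simp]:
  "EFobj (sel_efunc C F) p = p" "EFcat (sel_efunc C F) p = sel_func C F p"
  by (simp_all add: sel_efunc_def sel_func_def)

lemma sel_efunc_ident:
  "sel_efunc C (func_restrict C id_func) = efunc_restrict (sel_ecat C) id_efunc"
  unfolding sel_efunc_def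
proof (rule efunc_restrict_cong)
  \<comment> \<open>Selection objects and morphisms consist of extensional families, so applying the
    identity on the directions only gives back the same family.\<close>
  have hom: "sel_map_hom q (func_restrict C id_func) x y h = h"
    if "x \<in> sel_obj C p" "y \<in> sel_obj C q" "h \<in> sel_hom C p q x y" for p q x y h
    using that
    by (cases x; cases y; cases h) (auto simp: PiE_iff fun_eq_iff extensional_def)
  have obj: "sel_map_obj p (func_restrict C id_func) x = x" if "x \<in> sel_obj C p" for p x
    using that by (cases x) (auto simp: PiE_iff fun_eq_iff extensional_def)
  show "func_restrict (ECat (sel_ecat C) p) (EFcat \<lparr>EFobj = \<lambda>p. p,
        EFcat = sel_func C (func_restrict C id_func),
        EFhom = \<lambda>p q. sel_map_hom q (func_restrict C id_func)\<rparr> p)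
      = func_restrict (ECat (sel_ecat C) p) (EFcat id_efunc p)" for p
    by (rule func_restrict_cong) (simp_all add: sel_func_def hom obj)
  show "EFhom \<lparr>EFobj = \<lambda>p. p, EFcat = sel_func C (func_restrict C id_func),
        EFhom = \<lambda>p q. sel_map_hom q (func_restrict C id_func)\<rparr> p q x y h
      = EFhom id_efunc p q x y h"
    if "x \<in> Obj (ECat (sel_ecat C) p)" "y \<in> Obj (ECat (sel_ecat C) q)"
      "h \<in> Fobj (EHom (sel_ecat C) p q) (x, y)" for p q x y h
    using that by (simp add: hom)
qed simp

text \<open>Applying \<open>F\<close> and then \<open>G\<close> at each direction is applying the
  composite. \<open>sel_efunc D G\<close> is restricted, so it is essential that \<open>F\<close>
  sends families and morphisms over \<open>C\<close> to ones over \<open>D\<close>.\<close>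

lemma sel_efunc_comp:
  assumes "cat_functor C D F"
  shows "sel_efunc C (func_restrict C (comp_func G F))
    = efunc_restrict (sel_ecat C) (comp_efunc (sel_efunc D G) (sel_efunc C F))"
proof -
  interpret cat_functor C D F by fact
  have hom: "sel_map_hom q (func_restrict C (comp_func G F)) x y h
      = sel_map_hom q G (sel_map_obj p F x) (sel_map_obj q F y) (sel_map_hom q F x y h)"
    if "x \<in> sel_obj C p" "y \<in> sel_obj C q" "h \<in> sel_hom C p q x y" for p q x y h
    using that
    by (cases x; cases y; cases h) (auto simp: PiE_iff intro!: restrict_ext)
  have obj: "sel_map_obj p (func_restrict C (comp_func G F)) x
      = sel_map_obj p G (sel_map_obj p F x)" if "x \<in> sel_obj C p" for p x
    using that by (cases x) (auto simp: PiE_iff intro!: restrict_ext)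
  let ?GF = "func_restrict C (comp_func G F)"
  let ?E = "\<lparr>EFobj = \<lambda>p. p, EFcat = sel_func C ?GF, EFhom = \<lambda>p q. sel_map_hom q ?GF\<rparr>"
  have "efunc_restrict (sel_ecat C) ?E
      = efunc_restrict (sel_ecat C) (comp_efunc (sel_efunc D G) (sel_efunc C F))"
  proof (rule efunc_restrict_cong)
    show "func_restrict (ECat (sel_ecat C) p) (EFcat ?E p) = func_restrict (ECat (sel_ecat C) p)
        (EFcat (comp_efunc (sel_efunc D G) (sel_efunc C F)) p)" for p
      by (rule func_restrict_cong)
        (simp_all add: sel_func_def hom obj sel_map_obj_in sel_map_hom_in)
    show "EFhom ?E p q x y h = EFhom (comp_efunc (sel_efunc D G) (sel_efunc C F)) p q x y h"
      if "x \<in> Obj (ECat (sel_ecat C) p)" "y \<in> Obj (ECat (sel_ecat C) q)"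
        "h \<in> Fobj (EHom (sel_ecat C) p q) (x, y)" for p q x y h
      using that
      by (simp add: sel_efunc_def sel_func_def hom sel_map_obj_in sel_map_hom_in)
  qed simp
  \<comment> \<open>Only the instance on the left is unfolded, leaving the two factors on the right
    intact.\<close>
  then show ?thesis by (simp add: sel_efunc_def[of C ?GF])
qed

lemma cat_functor_selection: "cat_functor Cat Prof_Cat selection"
proof -
  interpret C: category Cat by (rule category_Cat)
  interpret P: category Prof_Cat by (rule category_Prof_Cat)
  have "efunc_restrict (sel_ecat C) (sel_efunc C F) = sel_efunc C F" for C F
    by (simp add: sel_efunc_def)
  then show ?thesis
    by unfold_locales (auto simp: category.prof_category_sel_ecat sel_efunc_ident sel_efunc_comp
        intro: cat_functor.prof_functor_sel_efunc)
qed

text \<open>The enriched functors are the identity on polynomials, so the condition on arrows is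
  \<open>bij_on_objects_sel_func\<close> at every \<open>p\<close>.\<close>

lemma cat_functor_selection_bo: "cat_functor Cat_bo Prof_bo_Cat selection"
  using category_Cat_bo category_Prof_bo_Cat unfolding Cat_bo_def Prof_bo_Cat_def
  by (intro cat_functor_wide_subcat[OF cat_functor_selection])
    (auto intro: cat_functor.bij_on_objects_sel_func)

lemma cat_functor_selection_ff: "cat_functor Cat_ff Prof_ff_Cat selection"
  using category_Cat_ff category_Prof_ff_Cat unfolding Cat_ff_def Prof_ff_Cat_def
  by (intro cat_functor_wide_subcat[OF cat_functor_selection])
    (auto intro: cat_functor.fully_faithful_sel_func)

text \<open>The functor claims fix one pair of types as universe for source and target. The last two
  conjuncts give the claim on components also when \<open>C\<close> and \<open>C'\<close> live over
  different types.\<close>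

theorem proposition6p3:
  fixes C :: "('o1, 'm1) cat" and C' :: "('o2, 'm2) cat"
    and F :: "('o1, 'm1, 'o2, 'm2) func" and p :: "('i, 'a) poly"
  shows "cat_functor Cat Prof_Cat (selection :: ('i, 'a, 'o, 'm) selfunctor)
    \<and> cat_functor Cat_bo Prof_bo_Cat (selection :: ('i, 'a, 'o, 'm) selfunctor)
    \<and> cat_functor Cat_ff Prof_ff_Cat (selection :: ('i, 'a, 'o, 'm) selfunctor)
    \<and> (cat_functor C C' F \<and> bij_on_objects C C' F \<longrightarrow>
        cat_functor (sel_cat C p) (sel_cat C' p) (sel_func C F p)
        \<and> bij_on_objects (sel_cat C p) (sel_cat C' p) (sel_func C F p))
    \<and> (cat_functor C C' F \<and> fully_faithful C C' F \<longrightarrow>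
        cat_functor (sel_cat C p) (sel_cat C' p) (sel_func C F p)
        \<and> fully_faithful (sel_cat C p) (sel_cat C' p) (sel_func C F p))"
  using cat_functor_selection cat_functor_selection_bo cat_functor_selection_ff
  by (auto intro: cat_functor.cat_functor_sel_func cat_functor.bij_on_objects_sel_func
      cat_functor.fully_faithful_sel_func)

end
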